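(* Let $N\in\mathbb{N}$, let $\nu\in P(E)$ be an initial distribution and $F_0=\nu$. Assume that $H:P(E)\to\mathbb{R}$ is upper semicontinuous, i.e. $\limsup_{k\to\infty}H(F_{(k)})\le H(F)$ for any sequence $(F_{(k)})$ converging to $F$ in $P(E)$, and that the mappings $a\mapsto q(x'|x,a)$ and $a\mapsto r(x,a)$ are continuous on $A$ for all $x,x'\in E$. Define recursively, for $F\in P(E)$, $$J_N(F):=H(F),\qquad J_n(F):=\sup_{\pi\in\Pi^M}\big\{\hat r(F,\pi)+J_{n+1}(T^\pi(F))\big\},\quad n=N-1,\ldots,0.$$ Then: a) $J_0(F_0)=\sup_{\sigma\in\Pi_N}\big\{H(F_N^\sigma)+\mathbb{E}_\nu^\sigma[R_{N-1}]\big\}$. b) Maximizers exist: for every $n=0,\ldots,N-1$ there is a map $f_n^*:P(E)\to\Pi^M$ such that for all $F\in P(E)$, $f_n^*(F)$ is a maximum point of $\pi\mapsto\hat r(F,\pi)+J_{n+1}(T^\pi(F))$ over $\Pi^M$. c) Given such maximizers $(f_0^*,\ldots,f_{N-1}^* )$, define, starting with $F_0=\nu$, successively $\pi_n^*:=f_n^*(F_n)$ and $F_{n+1}:=T^{\pi_n^*}(F_n)=T^{\pi_n^*}\circ\cdots\circ T^{\pi_0^*}(F_0)$ for $n=0,\ldots,N-1$. Then the policy $\sigma^*=(\sigma_0^*,\ldots,\sigma_{N-1}^* )$ given by $\sigma_n^*(\cdot|h_n)=\pi_n^*(\cdot|x_n)$ for $h_n=(x_0,a_0,\ldots,x_n)$,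 $n=0,\ldots,N-1$, is optimal, i.e. it attains the supremum $\sup_{\sigma\in\Pi_N}\{H(F_N^\sigma)+\mathbb{E}_\nu^\sigma[R_{N-1}]\}$.
   Context: MDP with finite horizon $N\in\mathbb{N}$: $E$ is a finite nonempty state space, $A$ a nonempty compact metric space (action space, with its Borel $\sigma$-algebra), $r:E\times A\to\mathbb{R}$ the one-stage reward, $q(\cdot|x,a)$ a transition probability from $E\times A$ to $E$. For a Borel space $Y$, $P(Y)$ is the set of Borel probability measures on $Y$ with the weak topology; since $E$ is finite, $F_{(k)}\to F$ in $P(E)$ means $F_{(k)}(x)\to F(x)$ for every $x\in E$. Histories: $H_0=E$, $H_n=E\times(A\times E)^n$, with elements $h_n=(x_0,a_0,\ldots,x_n)$. A policy $\sigma=(\sigma_n)_{n=0}^{N-1}$ is a sequence of history-dependent randomized decision rules, $\sigma_n(\cdot|h_n)\in P(A)$ being a (measurable) transition kernel from $H_n$ to $A$; $\Pi_N$ is the set of all policies. $\nu$, $\sigma$ and $q$ define in the standard way a unique probability measure $\mathbb{P}_\nu^\sigma$ on $E\times(A\times E)^N$ with expectation $\mathbb{E}_\nu^\sigma$, under which the coordinate processes $X_n$ (states) and $A_n$ (actions) satisfy: $X_0\sim\nu$, $A_n$ has conditional law $\sigma_n(\cdot|h_n)$ given history $h_n$, and $X_{n+1}$ has conditional law $q(\cdot|x_n,a_n)$ given $(h_n,a_n)$. Put $R_{N-1}=\sum_{k=0}^{N-1}r(X_k,A_k)$ and $F_n^\sigma(x)=\mathbb{P}_\nu^\sigma(X_n=x)$,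 $x\in E$. Lifted model: $\Pi^M=\{\pi:E\to P(A)\}$, written $\pi(da|x)$; for $F\in P(E)$ and $\pi\in\Pi^M$, $$\hat r(F,\pi)=\sum_{x\in E}\int_A r(x,a)\,\pi(da|x)\,F(x),\qquad T^\pi(F)(x')=\sum_{x\in E}\int_A q(x'|x,a)\,\pi(da|x)\,F(x),\quad x'\in E,$$ so $T^\pi:P(E)\to P(E)$. *)

theory Defs
  imports "HOL-Probability.Probability"
begin

text \<open>
  The finite state space \<open>E\<close> is a type \<open>'e::finite\<close> and \<open>P(E)\<close> is \<open>'e pmf\<close>. The action space \<open>A\<close>
  is a type \<open>'a::metric_space\<close> with its Borel sigma-algebra; its compactness is an explicit
  assumption of the theorem. A transition probability is \<open>q :: 'e \<Rightarrow> 'a \<Rightarrow> 'e pmf\<close>, with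
  \<open>q(x'|x,a) = pmf (q x a) x'\<close>.
\<close>

section \<open>The lifted model\<close>

definition markov_rules :: "('e::finite \<Rightarrow> 'a::metric_space measure) set" where
  "markov_rules = {\<pi>. \<forall>x. \<pi> x \<in> space (prob_algebra borel)}"

definition r_hat :: "('e::finite \<Rightarrow> 'a::metric_space \<Rightarrow> real) \<Rightarrow> 'e pmf \<Rightarrow> ('e \<Rightarrow> 'a measure) \<Rightarrow> real" where
  "r_hat r F \<pi> = (\<Sum>x\<in>UNIV. (\<integral>a. r x a \<partial>\<pi> x) * pmf F x)"

definition T_op :: "('e::finite \<Rightarrow> 'a::metric_space \<Rightarrow> 'e pmf) \<Rightarrow> ('e \<Rightarrow> 'a measure) \<Rightarrow> 'e pmf \<Rightarrow> 'e pmf" where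
  "T_op q \<pi> F = embed_pmf (\<lambda>x'. \<Sum>x\<in>UNIV. (\<integral>a. pmf (q x a) x' \<partial>\<pi> x) * pmf F x)"

definition usc_on_pmf :: "('e::finite pmf \<Rightarrow> real) \<Rightarrow> bool" where
  "usc_on_pmf H \<longleftrightarrow>
     (\<forall>F Fk. (\<forall>x. (\<lambda>k. pmf (Fk k) x) \<longlonglongrightarrow> pmf F x) \<longrightarrow>
        limsup (\<lambda>k. ereal (H (Fk k))) \<le> ereal (H F))"

text \<open>
  The suprema are taken in \<open>ereal\<close>, so that they are meaningful without prior knowledge of
  boundedness.
\<close>

function J :: "('e::finite \<Rightarrow> 'a::metric_space \<Rightarrow> real) \<Rightarrow> ('e \<Rightarrow> 'a \<Rightarrow> 'e pmf) \<Rightarrow> ('e pmf \<Rightarrow> real)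
    \<Rightarrow> nat \<Rightarrow> nat \<Rightarrow> 'e pmf \<Rightarrow> ereal" where
  "J r q H N n F =
     (if n < N then (SUP \<pi>\<in>markov_rules. ereal (r_hat r F \<pi>) + J r q H N (Suc n) (T_op q \<pi> F))
      else ereal (H F))"
  by auto
termination
  by (relation "Wellfounded.measure (\<lambda>(r, q, H, N, n, F). N - n)") auto

declare J.simps [simp del]

definition is_maximizer :: "('e::finite \<Rightarrow> 'a::metric_space \<Rightarrow> real) \<Rightarrow> ('e \<Rightarrow> 'a \<Rightarrow> 'e pmf)
    \<Rightarrow> ('e pmf \<Rightarrow> real) \<Rightarrow> nat \<Rightarrow> nat \<Rightarrow> ('e pmf \<Rightarrow> 'e \<Rightarrow> 'a measure) \<Rightarrow> bool" where
  "is_maximizer r q H N n f \<longleftrightarrow>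
     (\<forall>F. is_arg_max (\<lambda>\<pi>. ereal (r_hat r F \<pi>) + J r q H N (Suc n) (T_op q \<pi> F))
            (\<lambda>\<pi>. \<pi> \<in> markov_rules) (f F))"

section \<open>Histories, policies and the induced probability measure\<close>

text \<open>
  A history \<open>(x\<^sub>0, a\<^sub>0, x\<^sub>1, \<dots>, a\<^bsub>n-1\<^esub>, x\<^sub>n) \<in> E \<times> (A \<times> E)\<^sup>n\<close> is the pair of \<open>x\<^sub>0\<close> and the function
  \<open>k \<mapsto> (a\<^sub>k, x\<^bsub>k+1\<^esub>)\<close> on \<open>{..<n}\<close>, so the coordinates of the sequence are shifted: the
  state at time \<open>k + 1\<close> is paired with the action at time \<open>k\<close>.
\<close>

type_synonym ('e, 'a) history = "'e \<times> (nat \<Rightarrow> 'a \<times> 'e)"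

definition hist :: "nat \<Rightarrow> ('e::finite, 'a::metric_space) history measure" where
  "hist n = count_space UNIV \<Otimes>\<^sub>M (\<Pi>\<^sub>M k\<in>{..<n}. borel \<Otimes>\<^sub>M count_space UNIV)"

primrec state :: "nat \<Rightarrow> ('e, 'a) history \<Rightarrow> 'e" where
  "state 0 h = fst h"
| "state (Suc k) h = snd (snd h k)"

definition action :: "nat \<Rightarrow> ('e, 'a) history \<Rightarrow> 'a" where
  "action k h = fst (snd h k)"

text \<open>
  By compactness \<open>A\<close> is second countable, so the product sigma-algebra \<open>hist n\<close> is the Borel
  sigma-algebra of \<open>H\<^sub>n\<close>. Values of a policy at times \<open>n \<ge> N\<close> are irrelevant and left
  unconstrained.
\<close>

definition policies :: "nat \<Rightarrow> (nat \<Rightarrow> ('e::finite, 'a::metric_space) history \<Rightarrow> 'a measure) set" where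
  "policies N = {\<sigma>. \<forall>n<N. \<sigma> n \<in> hist n \<rightarrow>\<^sub>M prob_algebra borel}"

text \<open>
  \<open>traj q \<nu> \<sigma> n\<close> is the law of \<open>(X\<^sub>0, A\<^sub>0, \<dots>, X\<^sub>n)\<close>; \<open>traj q \<nu> \<sigma> N\<close> is the measure
  determined by \<open>\<nu>\<close>, \<open>\<sigma>\<close> and \<open>q\<close> on \<open>E \<times> (A \<times> E)\<^sup>N\<close>.
\<close>

primrec traj :: "('e::finite \<Rightarrow> 'a::metric_space \<Rightarrow> 'e pmf) \<Rightarrow> 'e pmf
    \<Rightarrow> (nat \<Rightarrow> ('e, 'a) history \<Rightarrow> 'a measure) \<Rightarrow> nat \<Rightarrow> ('e, 'a) history measure" where
  "traj q \<nu> \<sigma> 0 = distr (measure_pmf \<nu>) (hist 0) (\<lambda>x. (x, \<lambda>_. undefined))"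
| "traj q \<nu> \<sigma> (Suc n) =
     traj q \<nu> \<sigma> n \<bind> (\<lambda>h. \<sigma> n h \<bind> (\<lambda>a.
       distr (measure_pmf (q (state n h) a)) (hist (Suc n)) (\<lambda>x'. (fst h, (snd h)(n := (a, x'))))))"

definition state_law :: "('e::finite \<Rightarrow> 'a::metric_space \<Rightarrow> 'e pmf) \<Rightarrow> 'e pmf
    \<Rightarrow> (nat \<Rightarrow> ('e, 'a) history \<Rightarrow> 'a measure) \<Rightarrow> nat \<Rightarrow> nat \<Rightarrow> 'e pmf" where
  "state_law q \<nu> \<sigma> N n =
     embed_pmf (\<lambda>x. measure (traj q \<nu> \<sigma> N) {h \<in> space (traj q \<nu> \<sigma> N). state n h = x})"

definition policy_value :: "('e::finite \<Rightarrow> 'a::metric_space \<Rightarrow> real) \<Rightarrow> ('e \<Rightarrow> 'a \<Rightarrow> 'e pmf)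
    \<Rightarrow> ('e pmf \<Rightarrow> real) \<Rightarrow> nat \<Rightarrow> 'e pmf \<Rightarrow> (nat \<Rightarrow> ('e, 'a) history \<Rightarrow> 'a measure) \<Rightarrow> real" where
  "policy_value r q H N \<nu> \<sigma> =
     H (state_law q \<nu> \<sigma> N N) + (\<integral>h. (\<Sum>k<N. r (state k h) (action k h)) \<partial>traj q \<nu> \<sigma> N)"

primrec lifted_state :: "('e::finite \<Rightarrow> 'a::metric_space \<Rightarrow> 'e pmf) \<Rightarrow> 'e pmf
    \<Rightarrow> (nat \<Rightarrow> 'e pmf \<Rightarrow> 'e \<Rightarrow> 'a measure) \<Rightarrow> nat \<Rightarrow> 'e pmf" where
  "lifted_state q \<nu> f 0 = \<nu>"
| "lifted_state q \<nu> f (Suc n) =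
     T_op q (f n (lifted_state q \<nu> f n)) (lifted_state q \<nu> f n)"

definition feedback_policy :: "('e::finite \<Rightarrow> 'a::metric_space \<Rightarrow> 'e pmf) \<Rightarrow> 'e pmf
    \<Rightarrow> (nat \<Rightarrow> 'e pmf \<Rightarrow> 'e \<Rightarrow> 'a measure) \<Rightarrow> nat \<Rightarrow> ('e, 'a) history \<Rightarrow> 'a measure" where
  "feedback_policy q \<nu> f n h = f n (lifted_state q \<nu> f n) (state n h)"

section \<open>Well-definedness\<close>

text \<open>The arguments of \<open>embed_pmf\<close> above are probability vectors, so that \<open>pmf\<close> recovers them, and
  \<open>traj q \<nu> \<sigma> n\<close> is a probability measure on \<open>hist n\<close>.\<close>

lemma pmf_T_op:
  fixes q :: "'e::finite \<Rightarrow> 'a::metric_space \<Rightarrow> 'e pmf"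
  assumes q: "\<And>x x'. (\<lambda>a. pmf (q x a) x') \<in> borel_measurable borel"
    and \<pi>: "\<pi> \<in> markov_rules"
  shows "pmf (T_op q \<pi> F) x' = (\<Sum>x\<in>UNIV. (\<integral>a. pmf (q x a) x' \<partial>\<pi> x) * pmf F x)"
proof -
  have P: "prob_space (\<pi> x)" and S: "sets (\<pi> x) = sets borel" for x
    using \<pi> by (auto simp: markov_rules_def space_prob_algebra)
  have int: "integrable (\<pi> x) (\<lambda>a. pmf (q x a) y)" for x y
  proof -
    interpret prob_space "\<pi> x" by (rule P)
    show ?thesis
      by (rule integrable_const_bound[where B=1])
         (use q in \<open>auto simp: pmf_le_1 measurable_cong_sets[OF S refl]\<close>)
  qed
  have nn: "0 \<le> (\<Sum>x\<in>UNIV. (\<integral>a. pmf (q x a) y \<partial>\<pi> x) * pmf F x)" for y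
    by (intro sum_nonneg mult_nonneg_nonneg Bochner_Integration.integral_nonneg) auto
  have one: "(\<Sum>y\<in>UNIV. pmf p y) = 1" for p :: "'e pmf"
    by (rule sum_pmf_eq_1) auto
  have "(\<Sum>y\<in>UNIV. \<Sum>x\<in>UNIV. (\<integral>a. pmf (q x a) y \<partial>\<pi> x) * pmf F x)
      = (\<Sum>x\<in>UNIV. (\<Sum>y\<in>UNIV. \<integral>a. pmf (q x a) y \<partial>\<pi> x) * pmf F x)"
    by (subst sum.swap) (simp add: sum_distrib_right)
  also have "\<dots> = (\<Sum>x\<in>UNIV. (\<integral>a. (\<Sum>y\<in>UNIV. pmf (q x a) y) \<partial>\<pi> x) * pmf F x)"
    by (simp add: int Bochner_Integration.integral_sum)
  also have "\<dots> = 1"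
    using P by (simp add: one prob_space.prob_space)
  finally have s: "(\<Sum>y\<in>UNIV. \<Sum>x\<in>UNIV. (\<integral>a. pmf (q x a) y \<partial>\<pi> x) * pmf F x) = 1" .
  show ?thesis
    unfolding T_op_def
    by (rule pmf_embed_pmf[OF nn]) (simp add: nn_integral_count_space_finite sum_ennreal nn s)
qed

lemma measurable_state:
  assumes "k \<le> n"
  shows "state k \<in> hist n \<rightarrow>\<^sub>M count_space UNIV"
proof (cases k)
  case 0
  have "(\<lambda>h. fst h) \<in> hist n \<rightarrow>\<^sub>M count_space UNIV"
    unfolding hist_def by measurable
  then show ?thesis using 0 by (simp cong: measurable_cong)
next
  case (Suc j)
  have j: "j \<in> {..<n}" using Suc assms by simp
  have "(\<lambda>h. snd (snd h j)) \<in> hist n \<rightarrow>\<^sub>M count_space UNIV"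
    using j unfolding hist_def by measurable
  then show ?thesis using Suc by (simp cong: measurable_cong)
qed

lemma traj_in_prob_algebra:
  fixes q :: "'e::finite \<Rightarrow> 'a::metric_space \<Rightarrow> 'e pmf"
  assumes q: "\<And>x x'. (\<lambda>a. pmf (q x a) x') \<in> borel_measurable borel"
    and \<sigma>: "\<sigma> \<in> policies n"
  shows "traj q \<nu> \<sigma> n \<in> space (prob_algebra (hist n))"
  using \<sigma>
proof (induction n)
  case 0
  have "(\<lambda>x. (x, \<lambda>_. undefined)) \<in> measure_pmf \<nu> \<rightarrow>\<^sub>M hist 0"
    by (auto simp: hist_def space_pair_measure space_PiM)
  then show ?case
    by (auto simp: space_prob_algebra intro: prob_space.prob_space_distr prob_space_measure_pmf)
next
  case (Suc n)
  have IH: "traj q \<nu> \<sigma> n \<in> space (prob_algebra (hist n))"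
    and [measurable]: "\<sigma> n \<in> hist n \<rightarrow>\<^sub>M prob_algebra borel"
    using Suc by (auto simp: policies_def)
  note [measurable] = measurable_state[of n n, OF order_refl]
  have q1: "(\<lambda>a. measure_pmf (q x a)) \<in> borel \<rightarrow>\<^sub>M prob_algebra (count_space UNIV)" for x
  proof (rule measurable_prob_algebraI)
    show "prob_space (measure_pmf (q x a))" for a by (rule prob_space_measure_pmf)
    show "(\<lambda>a. measure_pmf (q x a)) \<in> borel \<rightarrow>\<^sub>M subprob_algebra (count_space UNIV)"
    proof (rule measurable_subprob_algebra)
      fix B :: "'e set"
      have "emeasure (measure_pmf (q x a)) B = (\<Sum>y\<in>B. ennreal (pmf (q x a) y))" for a
        by (simp add: emeasure_measure_pmf_finite)
      then show "(\<lambda>a. emeasure (measure_pmf (q x a)) B) \<in> borel_measurable borel"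
        using q by simp
    qed (auto simp: measure_pmf.subprob_space_axioms)
  qed
  have q2: "(\<lambda>p. measure_pmf (q (state n (fst p)) (snd p)))
      \<in> hist n \<Otimes>\<^sub>M borel \<rightarrow>\<^sub>M prob_algebra (count_space UNIV)"
    by (rule measurable_compose_countable[of "\<lambda>x p. measure_pmf (q x (snd p))" _ _ "\<lambda>p. state n (fst p)"])
       (use q1 in measurable)
  have upd: "(\<lambda>(p, x'). (fst (fst p), (snd (fst p))(n := (snd p, x'))))
      \<in> (hist n \<Otimes>\<^sub>M borel) \<Otimes>\<^sub>M count_space UNIV \<rightarrow>\<^sub>M (hist (Suc n) :: ('e, 'a) history measure)"
    unfolding hist_def lessThan_Suc by measurable
  have K: "(\<lambda>(h, a). distr (measure_pmf (q (state n h) a)) (hist (Suc n))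
        (\<lambda>x'. (fst h, (snd h)(n := (a, x')))))
      \<in> hist n \<Otimes>\<^sub>M borel \<rightarrow>\<^sub>M prob_algebra (hist (Suc n))"
    using measurable_distr_prob_space2[OF q2 upd] by (simp add: split_beta)
  have "(\<lambda>h. \<sigma> n h \<bind> (\<lambda>a. distr (measure_pmf (q (state n h) a)) (hist (Suc n))
        (\<lambda>x'. (fst h, (snd h)(n := (a, x'))))))
      \<in> hist n \<rightarrow>\<^sub>M prob_algebra (hist (Suc n))"
    by (rule measurable_bind_prob_space2[OF _ K]) measurable
  from measurable_bind_prob_space[OF measurable_const[OF IH] this, THEN measurable_space,
      of undefined "count_space UNIV"]
  show ?case by simp
qed

lemma pmf_state_law:
  fixes q :: "'e::finite \<Rightarrow> 'a::metric_space \<Rightarrow> 'e pmf"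
  assumes q: "\<And>x x'. (\<lambda>a. pmf (q x a) x') \<in> borel_measurable borel"
    and \<sigma>: "\<sigma> \<in> policies N" and n: "n \<le> N"
  shows "pmf (state_law q \<nu> \<sigma> N n) x =
    measure (traj q \<nu> \<sigma> N) {h \<in> space (traj q \<nu> \<sigma> N). state n h = x}"
proof -
  let ?M = "traj q \<nu> \<sigma> N"
  let ?S = "\<lambda>x. {h \<in> space ?M. state n h = x}"
  have M: "prob_space ?M" "sets ?M = sets (hist N)"
    using traj_in_prob_algebra[OF q \<sigma>] by (auto simp: space_prob_algebra)
  interpret prob_space ?M by (rule M)
  have [measurable]: "state n \<in> ?M \<rightarrow>\<^sub>M count_space UNIV"
    using measurable_state[OF n] by (simp add: measurable_cong_sets[OF M(2) refl])
  have "(\<Sum>y\<in>UNIV. measure ?M (?S y)) = measure ?M (\<Union>y. ?S y)"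
    by (rule finite_measure_finite_Union[symmetric]) (auto simp: disjoint_family_on_def)
  also have "(\<Union>y. ?S y) = space ?M" by auto
  finally have "(\<Sum>y\<in>UNIV. measure ?M (?S y)) = 1" by (simp add: prob_space)
  then show ?thesis
    unfolding state_law_def
    by (intro pmf_embed_pmf) (simp_all add: nn_integral_count_space_finite sum_ennreal)
qed

end

theory Submission
  imports Defs
begin

text \<open>
  The objective \<open>H(F\<^sub>N) + E[R]\<close> is not an expectation when \<open>H\<close> is nonlinear, but it depends on a policy
  only through the laws of the pairs \<open>(X\<^sub>n, A\<^sub>n)\<close> and of \<open>X\<^sub>N\<close>. Let \<open>\<pi>\<^sub>n\<close> be the conditional law of
  \<open>A\<^sub>n\<close> given \<open>X\<^sub>n\<close>. Then the state laws satisfy \<open>F\<^bsub>n+1\<^esub> = T(\<pi>\<^sub>n, F\<^sub>n)\<close>, and the expected reward is the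
  sum of the terms \<open>r_hat(F\<^sub>n, \<pi>\<^sub>n)\<close> (\<open>state_law_markov_projection\<close> and
  \<open>policy_value_markov_projection\<close>). The problem is thus a deterministic control problem whose
  states are distributions \<open>F\<close> and whose actions are decision rules \<open>\<pi>\<close>, and \<open>J\<close> is its dynamic
  programming recursion. No policy gains more than \<open>J\<close> at time 0
  (\<open>J_ge_lifted_trajectory\<close>), and a trajectory of maximizers gains exactly this value
  (\<open>J_eq_maximizing_trajectory\<close>). Following the maximizers with a Markov policy realises that trajectory
  in the original model, so all claims follow once maximizers exist.

  Maximizers exist because an upper semicontinuous function attains its maximum on a compact set,
  and the maximum is again upper semicontinuous in \<open>F\<close>, so that backward induction applies
  (\<open>bellman_limsup\<close>, \<open>J_real_usc\<close>). The compactness is finite-dimensional: a decision rule enters the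
  lifted model only through the integrals of \<open>r(x,\<cdot>)\<close> and \<open>q(x'|x,\<cdot>)\<close>, that is, through finitely many
  barycenters. The barycenters of a continuous function on a compact space with values in a Euclidean
  space form the convex hull of its range, which is compact, so any sequence of decision rules has a
  subsequence whose barycenters converge to those of another decision rule
  (\<open>markov_rules_seq_compact\<close>).
\<close>

section \<open>Barycenters of probability measures on a compact space\<close>

text \<open>
  In finite dimension the convex hull of the compact range is compact. A point outside it is
  strictly separated from it by a hyperplane, but the average of a linear functional against a
  probability measure cannot fall below a lower bound of the functional on the range.
\<close>
lemma barycenter_in_convex_hull:
  fixes g :: "'a::metric_space \<Rightarrow> 'b::euclidean_space"
  assumes A: "compact (UNIV :: 'a set)" and g: "continuous_on UNIV g"
    and M: "M \<in> space (prob_algebra borel)"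
  shows "integrable M g" and "(\<integral>a. g a \<partial>M) \<in> convex hull range g"
proof -
  have S: "sets M = sets borel" and P: "prob_space M"
    using M by (auto simp: space_prob_algebra)
  interpret prob_space M by (rule P)
  have comp: "compact (range g)"
    using g A by (rule compact_continuous_image)
  then obtain B where B: "\<And>a. norm (g a) \<le> B"
    using compact_imp_bounded[OF comp] by (auto simp: bounded_iff)
  have [measurable]: "g \<in> borel_measurable M"
    using borel_measurable_continuous_onI[OF g] by (simp add: measurable_cong_sets[OF S refl])
  show int: "integrable M g"
    by (rule integrable_const_bound[where B=B]) (auto simp: B)
  show "(\<integral>a. g a \<partial>M) \<in> convex hull range g"
  proof (rule ccontr)
    assume "(\<integral>a. g a \<partial>M) \<notin> convex hull range g"
    then obtain v b where v: "v \<bullet> (\<integral>a. g a \<partial>M) < b" "\<And>y. y \<in> convex hull range g \<Longrightarrow> b < v \<bullet> y"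
      using separating_hyperplane_closed_point[OF convex_convex_hull
          compact_imp_closed[OF compact_convex_hull[OF comp]]] by blast
    have "b = (\<integral>a. b \<partial>M)" by (simp add: prob_space)
    also have "\<dots> \<le> (\<integral>a. v \<bullet> g a \<partial>M)"
      using v(2)[OF hull_inc] int by (intro integral_mono) (auto intro: less_imp_le)
    also have "\<dots> = v \<bullet> (\<integral>a. g a \<partial>M)"
      using int by simp
    finally show False using v(1) by simp
  qed
qed

text \<open>
  A convex combination of values of \<open>g\<close> is the integral of \<open>g\<close> against a finitely supported
  measure on preimages. For continuous \<open>g\<close> on a compact space, barycenters therefore fill the whole
  convex hull, and limits of barycenters are barycenters.
\<close>
lemma convex_hull_is_barycenter:
  fixes g :: "'a::metric_space \<Rightarrow> 'b::euclidean_space"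
  assumes g: "g \<in> borel_measurable borel" and y: "y \<in> convex hull range g"
  obtains M where "M \<in> space (prob_algebra borel)" "(\<integral>a. g a \<partial>M) = y"
proof -
  obtain S u where S: "finite S" "S \<subseteq> range g" and u: "\<And>v. v \<in> S \<Longrightarrow> 0 \<le> u v" "sum u S = 1"
    and y_eq: "(\<Sum>v\<in>S. u v *\<^sub>R v) = y"
    using y unfolding convex_hull_explicit by blast
  \<comment> \<open>the measure is the image of the weights on \<open>S\<close> under a choice of preimages, so \<open>w\<close> extends
    them by zero to a probability vector\<close>
  define w where "w v = (if v \<in> S then u v else 0)" for v
  have w0: "0 \<le> w v" for v using u by (simp add: w_def)
  have "(\<integral>\<^sup>+v. ennreal (w v) \<partial>count_space UNIV) = (\<integral>\<^sup>+v. ennreal (u v) \<partial>count_space S)"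
    by (subst nn_integral_count_space_indicator[of S])
       (auto simp: w_def indicator_def intro!: nn_integral_cong)
  also have "\<dots> = 1"
    using S u by (simp add: nn_integral_count_space_finite sum_ennreal)
  finally have w1: "(\<integral>\<^sup>+v. ennreal (w v) \<partial>count_space UNIV) = 1" .
  define p where "p = embed_pmf w"
  have p: "pmf p v = w v" for v
    unfolding p_def by (rule pmf_embed_pmf[OF w0 w1])
  have supp: "v \<in> S" if "v \<in> set_pmf p" for v
    using that by (auto simp: set_pmf_iff p w_def split: if_splits)
  define M where "M = distr (measure_pmf p) (borel :: 'a measure) (inv g)"
  have "M \<in> space (prob_algebra borel)"
    by (auto simp: M_def space_prob_algebra intro: prob_space.prob_space_distr prob_space_measure_pmf)
  moreover have "(\<integral>a. g a \<partial>M) = (\<integral>v. g (inv g v) \<partial>measure_pmf p)"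
    unfolding M_def using g by (subst integral_distr) auto
  moreover have "\<dots> = (\<Sum>v\<in>S. pmf p v *\<^sub>R g (inv g v))"
    by (rule integral_measure_pmf) (use S supp in auto)
  moreover have "\<dots> = (\<Sum>v\<in>S. u v *\<^sub>R v)"
    using S by (intro sum.cong) (auto simp: p w_def f_inv_into_f)
  ultimately show ?thesis using that y_eq by metis
qed

section \<open>Compactness of the set of decision rules\<close>

lemma compact_Pi_UNIV:
  fixes K :: "'e \<Rightarrow> 'b::topological_space set"
  assumes "\<And>x. compact (K x)"
  shows "compact {b. \<forall>x. b x \<in> K x}"
proof -
  have "{b. \<forall>x. b x \<in> K x} = PiE UNIV K" by (auto simp: PiE_def Pi_def)
  moreover have "compactin (product_topology (\<lambda>_. euclidean) UNIV) (PiE UNIV K)"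
    using assms by (auto simp: compactin_PiE)
  ultimately show ?thesis by (simp add: euclidean_product_topology)
qed

text \<open>
  Only the integrals of a continuous vector function \<open>g x\<close> are asked to converge. They range over
  the product of the compact sets \<open>convex hull range (g x)\<close>, and a limit point of this product is
  again realised by a decision rule; no limit of the measures themselves is taken.
\<close>
lemma markov_rules_seq_compact:
  fixes g :: "'e::finite \<Rightarrow> 'a::metric_space \<Rightarrow> 'b::euclidean_space"
  assumes A: "compact (UNIV :: 'a set)" and g: "\<And>x. continuous_on UNIV (g x)"
    and \<pi>: "\<And>k. \<pi> k \<in> markov_rules"
  obtains s \<rho> where "strict_mono (s :: nat \<Rightarrow> nat)" "\<rho> \<in> markov_rules"
    "\<And>x. (\<lambda>k. \<integral>a. g x a \<partial>\<pi> (s k) x) \<longlonglongrightarrow> (\<integral>a. g x a \<partial>\<rho> x)"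
proof -
  define K where "K x = convex hull range (g x)" for x
  have "compact (K x)" for x
    unfolding K_def by (intro compact_convex_hull compact_continuous_image g A)
  then have "seq_compact {b. \<forall>x. b x \<in> K x}"
    by (intro compact_imp_seq_compact compact_Pi_UNIV)
  moreover have "\<forall>k. (\<lambda>x. \<integral>a. g x a \<partial>\<pi> k x) \<in> {b. \<forall>x. b x \<in> K x}"
    using barycenter_in_convex_hull(2)[OF A g] \<pi> by (auto simp: K_def markov_rules_def)
  ultimately obtain b s where b: "\<And>x. b x \<in> K x" and s: "strict_mono (s :: nat \<Rightarrow> nat)"
    and lim: "((\<lambda>k x. \<integral>a. g x a \<partial>\<pi> k x) \<circ> s) \<longlonglongrightarrow> b"
    by (rule seq_compactE) auto
  have "\<exists>M. M \<in> space (prob_algebra borel) \<and> (\<integral>a. g x a \<partial>M) = b x" for x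
    using convex_hull_is_barycenter[OF borel_measurable_continuous_onI[OF g] b[unfolded K_def]]
    by metis
  then obtain \<rho> where \<rho>: "\<And>x. \<rho> x \<in> space (prob_algebra borel)" "\<And>x. (\<integral>a. g x a \<partial>\<rho> x) = b x"
    by metis
  show ?thesis
  proof
    show "strict_mono s" by fact
    show "\<rho> \<in> markov_rules" using \<rho> by (simp add: markov_rules_def)
    show "(\<lambda>k. \<integral>a. g x a \<partial>\<pi> (s k) x) \<longlonglongrightarrow> (\<integral>a. g x a \<partial>\<rho> x)" for x
      using continuous_on_tendsto_compose[OF continuous_on_product_coordinates[of x] lim]
      by (simp add: \<rho> o_def)
  qed
qed

lemma markov_rules_nonempty: "markov_rules \<noteq> {}"
proof -
  have "(\<lambda>_. return borel undefined) \<in> markov_rules"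
    by (auto simp: markov_rules_def space_prob_algebra intro: prob_space_return)
  then show ?thesis by auto
qed

section \<open>The Bellman recursion\<close>

context
  fixes r :: "'e::finite \<Rightarrow> 'a::metric_space \<Rightarrow> real" and q :: "'e \<Rightarrow> 'a \<Rightarrow> 'e pmf"
  assumes A: "compact (UNIV :: 'a set)"
    and q: "\<And>x x'. continuous_on UNIV (\<lambda>a. pmf (q x a) x')"
    and r: "\<And>x. continuous_on UNIV (\<lambda>a. r x a)"
begin

lemma borel_measurable_transition: "(\<lambda>a. pmf (q x a) x') \<in> borel_measurable borel"
  by (rule borel_measurable_continuous_onI[OF q])

text \<open>
  For each state \<open>x\<close> collect the reward and the transition probabilities into one vector function
  of the action. A decision rule enters \<open>r_hat\<close> and \<open>T_op\<close> only through the barycenters of these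
  functions, and bilinearly with \<open>F\<close>, so convergence of the barycenters suffices.
\<close>
lemma lifted_model_subsequence:
  assumes F: "\<And>x. (\<lambda>k. pmf (Fk k) x) \<longlonglongrightarrow> pmf F x" and \<pi>: "\<And>k. \<pi> k \<in> markov_rules"
  obtains s \<rho> where "strict_mono (s :: nat \<Rightarrow> nat)" "\<rho> \<in> markov_rules"
    "(\<lambda>k. r_hat r (Fk (s k)) (\<pi> (s k))) \<longlonglongrightarrow> r_hat r F \<rho>"
    "\<And>x'. (\<lambda>k. pmf (T_op q (\<pi> (s k)) (Fk (s k))) x') \<longlonglongrightarrow> pmf (T_op q \<rho> F) x'"
proof -
  define g :: "'e \<Rightarrow> 'a \<Rightarrow> real \<times> (real^'e)" where
    "g x a = (r x a, \<chi> x'. pmf (q x a) x')" for x a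
  have g: "continuous_on UNIV (g x)" for x
    unfolding g_def[abs_def] by (intro continuous_on_Pair continuous_on_vec_lambda q r)
  obtain s \<rho> where s: "strict_mono s" and \<rho>: "\<rho> \<in> markov_rules"
    and lim: "\<And>x. (\<lambda>k. \<integral>a. g x a \<partial>\<pi> (s k) x) \<longlonglongrightarrow> (\<integral>a. g x a \<partial>\<rho> x)"
    by (rule markov_rules_seq_compact[OF A g \<pi>]) (rule that)
  have int: "integrable (\<tau> x) (g x)" if "\<tau> \<in> markov_rules" for \<tau> x
    using barycenter_in_convex_hull(1)[OF A g] that by (simp add: markov_rules_def)
  have rq: "(\<integral>a. r x a \<partial>\<tau> x) = fst (\<integral>a. g x a \<partial>\<tau> x)"
    "(\<integral>a. pmf (q x a) x' \<partial>\<tau> x) = snd (\<integral>a. g x a \<partial>\<tau> x) $ x'" if "\<tau> \<in> markov_rules" for \<tau> x x'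
  proof -
    show "(\<integral>a. r x a \<partial>\<tau> x) = fst (\<integral>a. g x a \<partial>\<tau> x)"
      using integral_bounded_linear[OF bounded_linear_fst int[OF that], of x]
      unfolding g_def fst_conv by simp
    have "bounded_linear (\<lambda>v :: real \<times> (real^'e). snd v $ x')"
      by (intro bounded_linear_compose[OF bounded_linear_vec_nth bounded_linear_snd])
    from integral_bounded_linear[OF this int[OF that], of x]
    show "(\<integral>a. pmf (q x a) x' \<partial>\<tau> x) = snd (\<integral>a. g x a \<partial>\<tau> x) $ x'"
      unfolding g_def snd_conv vec_lambda_beta by simp
  qed
  have Fs: "(\<lambda>k. pmf (Fk (s k)) x) \<longlonglongrightarrow> pmf F x" for x
    using LIMSEQ_subseq_LIMSEQ[OF F s] by (simp add: o_def)
  show ?thesis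
  proof
    show "strict_mono s" "\<rho> \<in> markov_rules" by fact+
    show "(\<lambda>k. r_hat r (Fk (s k)) (\<pi> (s k))) \<longlonglongrightarrow> r_hat r F \<rho>"
      unfolding r_hat_def rq(1)[OF \<pi>] rq(1)[OF \<rho>]
      by (intro tendsto_intros lim Fs)
    show "(\<lambda>k. pmf (T_op q (\<pi> (s k)) (Fk (s k))) x') \<longlonglongrightarrow> pmf (T_op q \<rho> F) x'" for x'
      unfolding pmf_T_op[OF borel_measurable_transition \<pi>] pmf_T_op[OF borel_measurable_transition \<rho>]
        rq(2)[OF \<pi>] rq(2)[OF \<rho>]
      by (intro tendsto_intros lim Fs)
  qed
qed

text \<open>
  Along a suitable subsequence \<open>r_hat\<close> converges and the value of \<open>G\<close> at the limit is no
  smaller than the limit superior. A constant sequence \<open>Fk\<close> with a maximizing sequence of rules yields a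
  maximizer; maximizing rules \<open>\<pi> k\<close> for each \<open>Fk k\<close> yield upper semicontinuity of the maximal value.
\<close>
lemma bellman_limsup:
  assumes G: "usc_on_pmf G"
    and F: "\<And>x. (\<lambda>k. pmf (Fk k) x) \<longlonglongrightarrow> pmf F x" and \<pi>: "\<And>k. \<pi> k \<in> markov_rules"
  obtains \<rho> where "\<rho> \<in> markov_rules"
    "limsup (\<lambda>k. ereal (r_hat r (Fk k) (\<pi> k) + G (T_op q (\<pi> k) (Fk k))))
      \<le> ereal (r_hat r F \<rho> + G (T_op q \<rho> F))"
proof -
  let ?c = "\<lambda>k. ereal (r_hat r (Fk k) (\<pi> k) + G (T_op q (\<pi> k) (Fk k)))"
  \<comment> \<open>the subsequence \<open>t\<close> realises the limit superior, so that passing to a further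
    subsequence \<open>s\<close> with convergent rules does not lower it\<close>
  obtain t where t: "strict_mono t" "(?c \<circ> t) \<longlonglongrightarrow> limsup ?c"
    using limsup_subseq_lim[of ?c] by (elim exE conjE)
  have Ft: "(\<lambda>k. pmf (Fk (t k)) x) \<longlonglongrightarrow> pmf F x" for x
    using LIMSEQ_subseq_LIMSEQ[OF F t(1)] by (simp add: o_def)
  obtain s \<rho> where s: "strict_mono s" and \<rho>: "\<rho> \<in> markov_rules"
    and rl: "(\<lambda>k. r_hat r (Fk (t (s k))) (\<pi> (t (s k)))) \<longlonglongrightarrow> r_hat r F \<rho>"
    and Tl: "\<And>x'. (\<lambda>k. pmf (T_op q (\<pi> (t (s k))) (Fk (t (s k)))) x') \<longlonglongrightarrow> pmf (T_op q \<rho> F) x'"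
    by (rule lifted_model_subsequence[where Fk="\<lambda>k. Fk (t k)" and \<pi>="\<lambda>k. \<pi> (t k)", OF Ft \<pi>])
       (rule that)
  let ?u = "\<lambda>k. ereal (r_hat r (Fk (t (s k))) (\<pi> (t (s k))))"
  let ?v = "\<lambda>k. ereal (G (T_op q (\<pi> (t (s k))) (Fk (t (s k)))))"
  have "(?c \<circ> t \<circ> s) \<longlonglongrightarrow> limsup ?c"
    using LIMSEQ_subseq_LIMSEQ[OF t(2) s] .
  then have "limsup ?c = limsup (\<lambda>k. ?u k + ?v k)"
    by (simp add: o_def lim_imp_Limsup)
  also have "\<dots> = ereal (r_hat r F \<rho>) + limsup ?v"
    by (rule ereal_limsup_lim_add) (use rl in auto)
  also have "\<dots> \<le> ereal (r_hat r F \<rho>) + ereal (G (T_op q \<rho> F))"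
    using G[unfolded usc_on_pmf_def, rule_format, OF Tl] by (rule add_left_mono)
  finally show ?thesis using \<rho> that by simp
qed

lemma bellman_max_attained:
  assumes G: "usc_on_pmf G"
  obtains \<rho> where "\<rho> \<in> markov_rules"
    "(SUP \<pi>\<in>markov_rules. ereal (r_hat r F \<pi> + G (T_op q \<pi> F)))
      = ereal (r_hat r F \<rho> + G (T_op q \<rho> F))"
proof -
  let ?c = "\<lambda>\<pi>. ereal (r_hat r F \<pi> + G (T_op q \<pi> F))"
  obtain f where f: "incseq f" "range f \<subseteq> ?c ` markov_rules" "Sup (?c ` markov_rules) = (SUP i. f i)"
    using Sup_countable_SUP[of "?c ` markov_rules"] markov_rules_nonempty by auto
  then have "\<forall>k. \<exists>\<pi>. \<pi> \<in> markov_rules \<and> f k = ?c \<pi>" by blast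
  then obtain \<pi> where \<pi>: "\<And>k. \<pi> k \<in> markov_rules" "\<And>k. f k = ?c (\<pi> k)" by metis
  obtain \<rho> where \<rho>: "\<rho> \<in> markov_rules" "limsup (\<lambda>k. ?c (\<pi> k)) \<le> ?c \<rho>"
    by (rule bellman_limsup[where Fk="\<lambda>_. F" and \<pi>=\<pi>, OF G tendsto_const \<pi>(1)]) (rule that)
  have "limsup f = Sup (?c ` markov_rules)"
    using LIMSEQ_SUP[OF f(1)] f(3) by (simp add: lim_imp_Limsup)
  then have "Sup (?c ` markov_rules) \<le> ?c \<rho>"
    using \<rho>(2) by (simp add: \<pi>(2)[abs_def, symmetric] flip: \<pi>(2))
  moreover have "?c \<rho> \<le> Sup (?c ` markov_rules)"
    using \<rho>(1) by (rule SUP_upper)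
  ultimately show ?thesis by (intro that[OF \<rho>(1)] antisym)
qed

lemma bellman_usc:
  assumes G: "usc_on_pmf G"
    and V: "\<And>F. ereal (V F) = (SUP \<pi>\<in>markov_rules. ereal (r_hat r F \<pi> + G (T_op q \<pi> F)))"
  shows "usc_on_pmf V"
  unfolding usc_on_pmf_def
proof (intro allI impI)
  fix F :: "'e pmf" and Fk assume F: "\<forall>x. (\<lambda>k. pmf (Fk k) x) \<longlonglongrightarrow> pmf F x"
  have "\<exists>\<pi>. \<pi> \<in> markov_rules \<and> V (Fk k) = r_hat r (Fk k) \<pi> + G (T_op q \<pi> (Fk k))" for k
    by (rule bellman_max_attained[OF G, of "Fk k"]) (use V[of "Fk k"] in auto)
  then obtain \<pi> where \<pi>: "\<And>k. \<pi> k \<in> markov_rules"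
    "\<And>k. V (Fk k) = r_hat r (Fk k) (\<pi> k) + G (T_op q (\<pi> k) (Fk k))" by metis
  obtain \<rho> where \<rho>: "\<rho> \<in> markov_rules"
    "limsup (\<lambda>k. ereal (r_hat r (Fk k) (\<pi> k) + G (T_op q (\<pi> k) (Fk k))))
      \<le> ereal (r_hat r F \<rho> + G (T_op q \<rho> F))"
    by (rule bellman_limsup[where \<pi>=\<pi>, OF G F[rule_format] \<pi>(1)]) (rule that)
  from \<rho>(2) have "limsup (\<lambda>k. ereal (V (Fk k))) \<le> ereal (r_hat r F \<rho> + G (T_op q \<rho> F))"
    by (simp only: \<pi>(2))
  also have "\<dots> \<le> ereal (V F)"
    unfolding V using \<rho>(1) by (rule SUP_upper)
  finally show "limsup (\<lambda>k. ereal (V (Fk k))) \<le> ereal (V F)" .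
qed

text \<open>
  Backward induction. The attained maximum of a real objective is real, so the values of \<open>J\<close> never
  become infinite, and upper semicontinuity is what makes the next maximum attained.
\<close>
lemma J_real_usc:
  assumes H: "usc_on_pmf H" and n: "n \<le> N"
  obtains V where "usc_on_pmf V" "\<And>F. J r q H N n F = ereal (V F)"
proof -
  have "\<exists>V. usc_on_pmf V \<and> (\<forall>F. J r q H N n F = ereal (V F))"
    using n
  proof (induction n rule: inc_induct)
    case base
    then show ?case using H by (intro exI[of _ H]) (simp add: J.simps)
  next
    case (step n)
    then obtain G where G: "usc_on_pmf G" "\<And>F. J r q H N (Suc n) F = ereal (G F)" by blast
    then have JS: "J r q H N n F = (SUP \<pi>\<in>markov_rules. ereal (r_hat r F \<pi> + G (T_op q \<pi> F)))" for F
      using step by (subst J.simps) simp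
    have "\<exists>v. J r q H N n F = ereal v" for F
      unfolding JS by (rule bellman_max_attained[OF G(1), of F]) auto
    then obtain V where V: "\<And>F. J r q H N n F = ereal (V F)" by metis
    moreover have "usc_on_pmf V"
      by (rule bellman_usc[OF G(1)]) (simp only: JS V[symmetric])
    ultimately show ?case by blast
  qed
  then show ?thesis using that by blast
qed

lemma is_maximizer_exists:
  assumes H: "usc_on_pmf H" and n: "n < N"
  shows "\<exists>f. is_maximizer r q H N n f"
proof -
  obtain G where G: "usc_on_pmf G" "\<And>F. J r q H N (Suc n) F = ereal (G F)"
    using J_real_usc[OF H, of "Suc n" N] n by auto
  have "\<exists>\<rho>. is_arg_max (\<lambda>\<pi>. ereal (r_hat r F \<pi>) + J r q H N (Suc n) (T_op q \<pi> F))
          (\<lambda>\<pi>. \<pi> \<in> markov_rules) \<rho>" for F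
  proof -
    obtain \<rho> where \<rho>: "\<rho> \<in> markov_rules"
      "(SUP \<pi>\<in>markov_rules. ereal (r_hat r F \<pi> + G (T_op q \<pi> F))) = ereal (r_hat r F \<rho> + G (T_op q \<rho> F))"
      by (rule bellman_max_attained[OF G(1), of F]) (rule that)
    have "ereal (r_hat r F \<pi> + G (T_op q \<pi> F)) \<le> ereal (r_hat r F \<rho> + G (T_op q \<rho> F))"
      if "\<pi> \<in> markov_rules" for \<pi>
      unfolding \<rho>(2)[symmetric] using that by (rule SUP_upper)
    then show ?thesis
      using \<rho>(1) by (intro exI[of _ \<rho>]) (auto simp: is_arg_max_def G(2) not_less)
  qed
  then show ?thesis unfolding is_maximizer_def by metis
qed

end

lemma J_maximizer:
  assumes f: "is_maximizer r q H N n f" and n: "n < N"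
  shows "f F \<in> markov_rules"
    and "J r q H N n F = ereal (r_hat r F (f F)) + J r q H N (Suc n) (T_op q (f F) F)"
proof -
  have *: "is_arg_max (\<lambda>\<pi>. ereal (r_hat r F \<pi>) + J r q H N (Suc n) (T_op q \<pi> F))
      (\<lambda>\<pi>. \<pi> \<in> markov_rules) (f F)"
    using f by (simp add: is_maximizer_def)
  then show M: "f F \<in> markov_rules" by (simp add: is_arg_max_def)
  show "J r q H N n F = ereal (r_hat r F (f F)) + J r q H N (Suc n) (T_op q (f F) F)"
    using * n by (subst J.simps) (auto simp: is_arg_max_def not_less intro!: SUP_eqI)
qed

text \<open>
  Every decision rule is admissible in the supremum defining \<open>J\<close>, so no sequence of decision rules
  can collect more along its deterministic trajectory of distributions than \<open>J\<close> promises.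
\<close>
lemma J_ge_lifted_trajectory:
  assumes \<pi>: "\<And>n. n < N \<Longrightarrow> \<pi> n \<in> markov_rules"
    and F: "\<And>n. n < N \<Longrightarrow> F (Suc n) = T_op q (\<pi> n) (F n)" and n: "n \<le> N"
  shows "ereal ((\<Sum>k\<in>{n..<N}. r_hat r (F k) (\<pi> k)) + H (F N)) \<le> J r q H N n (F n)"
  using n
proof (induction n rule: inc_induct)
  case base
  then show ?case by (simp add: J.simps)
next
  case (step n)
  have "ereal ((\<Sum>k\<in>{n..<N}. r_hat r (F k) (\<pi> k)) + H (F N))
      = ereal (r_hat r (F n) (\<pi> n)) + ereal ((\<Sum>k\<in>{Suc n..<N}. r_hat r (F k) (\<pi> k)) + H (F N))"
    using step by (simp add: sum.atLeast_Suc_lessThan)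
  also have "\<dots> \<le> ereal (r_hat r (F n) (\<pi> n)) + J r q H N (Suc n) (T_op q (\<pi> n) (F n))"
    using step F by (intro add_left_mono) auto
  also have "\<dots> \<le> J r q H N n (F n)"
    using step \<pi> by (subst (2) J.simps) (auto intro!: SUP_upper)
  finally show ?case .
qed

lemma J_eq_maximizing_trajectory:
  assumes f: "\<And>n. n < N \<Longrightarrow> is_maximizer r q H N n (f n)"
    and F: "\<And>n. n < N \<Longrightarrow> F (Suc n) = T_op q (f n (F n)) (F n)" and n: "n \<le> N"
  shows "J r q H N n (F n) = ereal ((\<Sum>k\<in>{n..<N}. r_hat r (F k) (f k (F k))) + H (F N))"
  using n
proof (induction n rule: inc_induct)
  case base
  then show ?case by (simp add: J.simps)
next
  case (step n)
  then show ?case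
    using J_maximizer(2)[OF f, of n "F n"] F[of n]
    by (simp add: sum.atLeast_Suc_lessThan)
qed

section \<open>Expectations along a trajectory\<close>

text \<open>
  Histories store the state at time \<open>n + 1\<close> together with the action at time \<open>n\<close>, so a single update
  at index \<open>n\<close> appends both to a history that ends with the state at time \<open>n\<close>.
\<close>
definition extend :: "nat \<Rightarrow> ('e, 'a) history \<Rightarrow> 'a \<Rightarrow> 'e \<Rightarrow> ('e, 'a) history" where
  "extend n h a x' = (fst h, (snd h)(n := (a, x')))"

lemma state_extend: "k \<le> n \<Longrightarrow> state k (extend n h a x') = state k h"
  by (cases k) (auto simp: extend_def)

lemma state_extend_Suc: "state (Suc n) (extend n h a x') = x'"
  by (simp add: extend_def)

lemma action_extend: "k < n \<Longrightarrow> action k (extend n h a x') = action k h"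
  by (simp add: extend_def action_def)

lemma action_extend_same: "action n (extend n h a x') = a"
  by (simp add: extend_def action_def)

lemma measurable_extend:
  "(\<lambda>((h, a), x'). extend n h a x')
    \<in> (hist n \<Otimes>\<^sub>M borel) \<Otimes>\<^sub>M count_space UNIV \<rightarrow>\<^sub>M
      (hist (Suc n) :: ('e::finite, 'a::metric_space) history measure)"
proof -
  have "(\<lambda>(p, x'). (fst (fst p), (snd (fst p))(n := (snd p, x'))))
      \<in> (hist n \<Otimes>\<^sub>M borel) \<Otimes>\<^sub>M count_space UNIV \<rightarrow>\<^sub>M (hist (Suc n) :: ('e, 'a) history measure)"
    unfolding hist_def lessThan_Suc by measurable
  also have "(\<lambda>(p, x'). (fst (fst p), (snd (fst p))(n := (snd p, x')))) = (\<lambda>((h, a), x'). extend n h a x')"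
    by (auto simp: extend_def)
  finally show ?thesis .
qed

lemma measurable_action:
  assumes "k < n"
  shows "action k \<in> (hist n :: ('e::finite, 'a::metric_space) history measure) \<rightarrow>\<^sub>M borel"
proof -
  have k: "k \<in> {..<n}" using assms by simp
  have "(\<lambda>h. fst (snd h k)) \<in> (hist n :: ('e, 'a) history measure) \<rightarrow>\<^sub>M borel"
    using k unfolding hist_def by measurable
  then show ?thesis by (simp add: action_def[abs_def])
qed

lemma measurable_state_action:
  fixes f :: "'e::finite \<Rightarrow> 'a::metric_space \<Rightarrow> real"
  assumes f: "\<And>x. f x \<in> borel_measurable borel" and k: "k < n"
  shows "(\<lambda>h. f (state k h) (action k h)) \<in> borel_measurable (hist n)"
  by (rule measurable_compose_countable[of "\<lambda>x h. f x (action k h)"])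
     (use k in \<open>auto intro: measurable_compose[OF measurable_action f] measurable_state\<close>)

lemma integral_bind_prob:
  fixes \<phi> :: "'b \<Rightarrow> real"
  assumes M: "M \<in> space (prob_algebra A)" and K: "K \<in> A \<rightarrow>\<^sub>M prob_algebra C"
    and \<phi>: "\<phi> \<in> borel_measurable C" and B: "\<And>y. \<bar>\<phi> y\<bar> \<le> B"
  shows "(\<integral>y. \<phi> y \<partial>(M \<bind> K)) = (\<integral>x. \<integral>y. \<phi> y \<partial>K x \<partial>M)"
proof -
  have S: "sets M = sets A" and P: "prob_space M"
    using M by (auto simp: space_prob_algebra)
  have K': "K \<in> M \<rightarrow>\<^sub>M prob_algebra C"
    using K by (simp add: measurable_cong_sets[OF S refl])
  have "prob_space (K x)" if "x \<in> space M" for x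
    using measurable_space[OF K' that] by (simp add: space_prob_algebra)
  then have "AE x in M. emeasure (K x) (space (K x)) \<le> ennreal 1"
    by (intro AE_I2) (simp add: prob_space.emeasure_space_1)
  then show ?thesis
    by (intro integral_bind[where K=C and B=B] \<phi> B measurable_prob_algebraD[OF K']
        prob_space.finite_measure P)
qed

context
  fixes q :: "'e::finite \<Rightarrow> 'a::metric_space \<Rightarrow> 'e pmf"
  assumes q: "\<And>x x'. (\<lambda>a. pmf (q x a) x') \<in> borel_measurable borel"
begin

lemma measurable_transition: "(\<lambda>a. measure_pmf (q x a)) \<in> borel \<rightarrow>\<^sub>M prob_algebra (count_space UNIV)"
proof (rule measurable_prob_algebraI)
  show "prob_space (measure_pmf (q x a))" for a by (rule prob_space_measure_pmf)
  show "(\<lambda>a. measure_pmf (q x a)) \<in> borel \<rightarrow>\<^sub>M subprob_algebra (count_space UNIV)"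
    using q by (intro measurable_subprob_algebra)
      (auto simp: measure_pmf.subprob_space_axioms emeasure_measure_pmf_finite)
qed

lemma measurable_step:
  "(\<lambda>(h, a). distr (measure_pmf (q (state n h) a)) (hist (Suc n)) (extend n h a))
    \<in> hist n \<Otimes>\<^sub>M borel \<rightarrow>\<^sub>M prob_algebra (hist (Suc n))"
proof -
  note [measurable] = measurable_state[of n n, OF order_refl]
  have "(\<lambda>p. measure_pmf (q (state n (fst p)) (snd p)))
      \<in> hist n \<Otimes>\<^sub>M borel \<rightarrow>\<^sub>M prob_algebra (count_space UNIV)"
    by (rule measurable_compose_countable[of "\<lambda>x p. measure_pmf (q x (snd p))" _ _ "\<lambda>p. state n (fst p)"])
       (use measurable_transition in measurable)
  moreover have "(\<lambda>(p, x'). extend n (fst p) (snd p) x')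
      \<in> (hist n \<Otimes>\<^sub>M borel) \<Otimes>\<^sub>M count_space UNIV \<rightarrow>\<^sub>M hist (Suc n)"
    using measurable_extend[of n] by (simp add: case_prod_unfold)
  ultimately have "(\<lambda>p. distr (measure_pmf (q (state n (fst p)) (snd p))) (hist (Suc n))
        (extend n (fst p) (snd p))) \<in> hist n \<Otimes>\<^sub>M borel \<rightarrow>\<^sub>M prob_algebra (hist (Suc n))"
    by (rule measurable_distr_prob_space2)
  then show ?thesis by (simp add: case_prod_unfold)
qed

lemma integral_traj_Suc:
  fixes \<phi> :: "('e, 'a) history \<Rightarrow> real"
  assumes \<sigma>: "\<sigma> \<in> policies (Suc n)" and \<phi>: "\<phi> \<in> borel_measurable (hist (Suc n))"
    and B: "\<And>h. \<bar>\<phi> h\<bar> \<le> B"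
  shows "(\<integral>h. \<phi> h \<partial>traj q \<nu> \<sigma> (Suc n))
    = (\<integral>h. \<integral>a. \<integral>x'. \<phi> (extend n h a x') \<partial>measure_pmf (q (state n h) a) \<partial>\<sigma> n h \<partial>traj q \<nu> \<sigma> n)"
proof -
  have M: "traj q \<nu> \<sigma> n \<in> space (prob_algebra (hist n))"
    using \<sigma> by (intro traj_in_prob_algebra q) (auto simp: policies_def)
  then have sp: "space (traj q \<nu> \<sigma> n) = space (hist n)"
    by (auto simp: space_prob_algebra dest: sets_eq_imp_space_eq)
  have \<sigma>n: "\<sigma> n \<in> hist n \<rightarrow>\<^sub>M prob_algebra borel"
    using \<sigma> by (auto simp: policies_def)
  let ?D = "\<lambda>h a. distr (measure_pmf (q (state n h) a)) (hist (Suc n)) (extend n h a)"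
  have K: "(\<lambda>h. \<sigma> n h \<bind> ?D h) \<in> hist n \<rightarrow>\<^sub>M prob_algebra (hist (Suc n))"
    by (rule measurable_bind_prob_space2[OF \<sigma>n measurable_step])
  have inner: "(\<integral>y. \<phi> y \<partial>(\<sigma> n h \<bind> ?D h))
      = (\<integral>a. \<integral>x'. \<phi> (extend n h a x') \<partial>measure_pmf (q (state n h) a) \<partial>\<sigma> n h)"
    if h: "h \<in> space (hist n)" for h
  proof -
    have D: "?D h \<in> borel \<rightarrow>\<^sub>M prob_algebra (hist (Suc n))"
      using measurable_compose[OF measurable_Pair1'[OF h] measurable_step] by simp
    have ext: "extend n h a x' \<in> space (hist (Suc n))" for a x'
      using measurable_space[OF measurable_extend, of "((h, a), x')" n] h
      by (simp add: space_pair_measure)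
    have "(\<integral>y. \<phi> y \<partial>?D h a) = (\<integral>x'. \<phi> (extend n h a x') \<partial>measure_pmf (q (state n h) a))" for a
      by (rule integral_distr[OF _ \<phi>]) (use ext in auto)
    then show ?thesis
      using integral_bind_prob[OF measurable_space[OF \<sigma>n h] D \<phi> B] by simp
  qed
  have "traj q \<nu> \<sigma> (Suc n) = traj q \<nu> \<sigma> n \<bind> (\<lambda>h. \<sigma> n h \<bind> ?D h)"
    by (simp add: extend_def[abs_def])
  then have "(\<integral>h. \<phi> h \<partial>traj q \<nu> \<sigma> (Suc n)) = (\<integral>h. \<integral>y. \<phi> y \<partial>(\<sigma> n h \<bind> ?D h) \<partial>traj q \<nu> \<sigma> n)"
    using integral_bind_prob[OF M K \<phi> B] by (simp only:)
  also have "\<dots> = (\<integral>h. \<integral>a. \<integral>x'. \<phi> (extend n h a x') \<partial>measure_pmf (q (state n h) a) \<partial>\<sigma> n h \<partial>traj q \<nu> \<sigma> n)"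
    by (rule Bochner_Integration.integral_cong[OF refl]) (simp only: inner sp)
  finally show ?thesis .
qed

text \<open>
  Later decisions do not change the law of what has already been observed, since the kernels that
  append an action and a state are probability kernels.
\<close>
lemma integral_traj_restrict:
  fixes \<phi> :: "('e, 'a) history \<Rightarrow> real"
  assumes \<sigma>: "\<sigma> \<in> policies N" and n: "n \<le> N"
    and \<phi>: "\<And>m. n \<le> m \<Longrightarrow> \<phi> \<in> borel_measurable (hist m)" and B: "\<And>h. \<bar>\<phi> h\<bar> \<le> B"
    and ext: "\<And>m h a x'. n \<le> m \<Longrightarrow> \<phi> (extend m h a x') = \<phi> h"
  shows "(\<integral>h. \<phi> h \<partial>traj q \<nu> \<sigma> N) = (\<integral>h. \<phi> h \<partial>traj q \<nu> \<sigma> n)"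
  using n \<sigma>
proof (induction N rule: dec_induct)
  case (step m)
  then have \<sigma>: "\<sigma> \<in> policies m" and \<sigma>m: "\<sigma> m \<in> hist m \<rightarrow>\<^sub>M prob_algebra borel"
    by (auto simp: policies_def)
  have M: "sets (traj q \<nu> \<sigma> m) = sets (hist m)"
    using traj_in_prob_algebra[OF q \<sigma>] by (auto simp: space_prob_algebra)
  have one: "prob_space (\<sigma> m h)" if "h \<in> space (traj q \<nu> \<sigma> m)" for h
    using measurable_space[OF \<sigma>m, of h] that sets_eq_imp_space_eq[OF M]
    by (simp add: space_prob_algebra)
  have "(\<integral>h. \<phi> h \<partial>traj q \<nu> \<sigma> (Suc m)) = (\<integral>h. \<integral>a. \<phi> h \<partial>\<sigma> m h \<partial>traj q \<nu> \<sigma> m)"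
    using step by (subst integral_traj_Suc[OF step.prems \<phi> B]) (simp_all add: ext)
  also have "\<dots> = (\<integral>h. \<phi> h \<partial>traj q \<nu> \<sigma> m)"
    using one by (intro Bochner_Integration.integral_cong) (auto simp: prob_space.prob_space)
  finally show ?case using step.IH \<sigma> by simp
qed simp

lemma expectation_state_action:
  assumes \<sigma>: "\<sigma> \<in> policies N" and n: "n < N"
    and f: "\<And>x. f x \<in> borel_measurable borel" and B: "\<And>x a. \<bar>f x a\<bar> \<le> (B :: real)"
  shows "(\<integral>h. f (state n h) (action n h) \<partial>traj q \<nu> \<sigma> N)
    = (\<integral>h. \<integral>a. f (state n h) a \<partial>\<sigma> n h \<partial>traj q \<nu> \<sigma> n)"
proof -
  have \<sigma>': "\<sigma> \<in> policies (Suc n)" using \<sigma> n by (auto simp: policies_def)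
  have "(\<integral>h. f (state n h) (action n h) \<partial>traj q \<nu> \<sigma> N)
      = (\<integral>h. f (state n h) (action n h) \<partial>traj q \<nu> \<sigma> (Suc n))"
    using n by (intro integral_traj_restrict[OF \<sigma>, where B=B] measurable_state_action f B)
      (auto simp: state_extend action_extend)
  also have "\<dots> = (\<integral>h. \<integral>a. f (state n h) a \<partial>\<sigma> n h \<partial>traj q \<nu> \<sigma> n)"
    by (subst integral_traj_Suc[OF \<sigma>' measurable_state_action[OF f lessI] B])
       (simp add: state_extend action_extend_same)
  finally show ?thesis .
qed

lemma expectation_state:
  fixes g :: "'e \<Rightarrow> real"
  assumes \<sigma>: "\<sigma> \<in> policies N" and n: "n \<le> N"
  shows "(\<integral>h. g (state n h) \<partial>traj q \<nu> \<sigma> n) = (\<Sum>x\<in>UNIV. g x * pmf (state_law q \<nu> \<sigma> N n) x)"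
proof -
  let ?M = "traj q \<nu> \<sigma> N"
  have M: "prob_space ?M" "sets ?M = sets (hist N)"
    using traj_in_prob_algebra[OF q \<sigma>] by (auto simp: space_prob_algebra)
  interpret prob_space ?M by (rule M)
  have st [measurable]: "state n \<in> ?M \<rightarrow>\<^sub>M count_space UNIV"
    using measurable_state[OF n] by (simp add: measurable_cong_sets[OF M(2) refl])
  let ?S = "\<lambda>x. {h \<in> space ?M. state n h = x}"
  have "(\<integral>h. g (state n h) \<partial>?M) = (\<integral>h. (\<Sum>x\<in>UNIV. g x * indicator (?S x) h) \<partial>?M)"
    by (intro Bochner_Integration.integral_cong) (auto simp: indicator_def)
  also have "\<dots> = (\<Sum>x\<in>UNIV. g x * measure ?M (?S x))"
    by (subst Bochner_Integration.integral_sum) (auto simp: Int_absorb2 emeasure_eq_measure)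
  finally have N: "(\<integral>h. g (state n h) \<partial>?M) = (\<Sum>x\<in>UNIV. g x * pmf (state_law q \<nu> \<sigma> N n) x)"
    using pmf_state_law[OF q \<sigma> n] by simp
  have B: "\<bar>g x\<bar> \<le> Max (range (\<lambda>x. \<bar>g x\<bar>))" for x
    by (rule Max_ge) auto
  have "(\<integral>h. g (state n h) \<partial>?M) = (\<integral>h. g (state n h) \<partial>traj q \<nu> \<sigma> n)"
    by (rule integral_traj_restrict[OF \<sigma> n _ B])
       (auto simp: state_extend intro: measurable_compose[OF measurable_state])
  then show "(\<integral>h. g (state n h) \<partial>traj q \<nu> \<sigma> n) = (\<Sum>x\<in>UNIV. g x * pmf (state_law q \<nu> \<sigma> N n) x)"
    using N by simp
qed

lemma pmf_state_law_eq_expectation: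
  assumes \<sigma>: "\<sigma> \<in> policies N" and n: "n \<le> N"
  shows "pmf (state_law q \<nu> \<sigma> N n) x = (\<integral>h. of_bool (state n h = x) \<partial>traj q \<nu> \<sigma> n)"
  by (subst expectation_state[OF \<sigma> n, where g="\<lambda>y. of_bool (y = x)"])
     (simp add: of_bool_def if_distrib[of "\<lambda>c. c * _"] cong: if_cong)

lemma state_law_0:
  assumes \<sigma>: "\<sigma> \<in> policies N"
  shows "state_law q \<nu> \<sigma> N 0 = \<nu>"
proof (rule pmf_eqI)
  fix x
  have "(\<lambda>x. (x, \<lambda>_. undefined)) \<in> measure_pmf \<nu> \<rightarrow>\<^sub>M (hist 0 :: ('e, 'a) history measure)"
    by (auto simp: hist_def space_pair_measure space_PiM)
  moreover have "(\<lambda>h. of_bool (state 0 h = x) :: real) \<in> borel_measurable (hist 0 :: ('e, 'a) history measure)"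
    by (rule measurable_compose[OF measurable_state[OF le0]]) simp
  ultimately have "pmf (state_law q \<nu> \<sigma> N 0) x = (\<integral>y. of_bool (y = x) \<partial>measure_pmf \<nu>)"
    unfolding pmf_state_law_eq_expectation[OF \<sigma> le0] traj.simps
    by (subst integral_distr) auto
  also have "\<dots> = pmf \<nu> x"
    by (subst integral_measure_pmf_real[of "{x}"]) auto
  finally show "pmf (state_law q \<nu> \<sigma> N 0) x = pmf \<nu> x" .
qed

lemma pmf_state_law_Suc:
  assumes \<sigma>: "\<sigma> \<in> policies N" and n: "n < N"
  shows "pmf (state_law q \<nu> \<sigma> N (Suc n)) x' = (\<integral>h. pmf (q (state n h) (action n h)) x' \<partial>traj q \<nu> \<sigma> N)"
proof -
  have \<sigma>': "\<sigma> \<in> policies (Suc n)" using \<sigma> n by (auto simp: policies_def)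
  have p: "(\<integral>y. of_bool (y = x') \<partial>measure_pmf p) = pmf p x'" for p :: "'e pmf"
    by (subst integral_measure_pmf_real[of "{x'}"]) auto
  have "pmf (state_law q \<nu> \<sigma> N (Suc n)) x'
      = (\<integral>h. of_bool (state (Suc n) h = x') \<partial>traj q \<nu> \<sigma> (Suc n))"
    using n by (intro pmf_state_law_eq_expectation[OF \<sigma>]) simp
  also have "\<dots> = (\<integral>h. \<integral>a. pmf (q (state n h) a) x' \<partial>\<sigma> n h \<partial>traj q \<nu> \<sigma> n)"
    by (subst integral_traj_Suc[OF \<sigma>', where B=1])
       (auto simp: state_extend_Suc p simp del: state.simps
         intro: measurable_compose[OF measurable_state[OF order_refl]])
  also have "\<dots> = (\<integral>h. pmf (q (state n h) (action n h)) x' \<partial>traj q \<nu> \<sigma> N)"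
    by (rule expectation_state_action[OF \<sigma> n, where B=1, symmetric]) (use q in \<open>auto simp: pmf_le_1\<close>)
  finally show ?thesis .
qed

end

section \<open>Markovian projection of a policy\<close>

text \<open>
  \<open>\<pi>\<close> is a version of the conditional law of \<open>A\<^sub>n\<close> given \<open>X\<^sub>n\<close>. It is characterised by integrals so
  that it stays undetermined at states which \<open>X\<^sub>n\<close> does not visit; at such states a maximizer may
  prescribe anything.
\<close>
definition markov_projection ::
    "('e::finite \<Rightarrow> 'a::metric_space \<Rightarrow> 'e pmf) \<Rightarrow> 'e pmf \<Rightarrow> (nat \<Rightarrow> ('e, 'a) history \<Rightarrow> 'a measure)
     \<Rightarrow> nat \<Rightarrow> nat \<Rightarrow> ('e \<Rightarrow> 'a measure) \<Rightarrow> bool" where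
  "markov_projection q \<nu> \<sigma> N n \<pi> \<longleftrightarrow> \<pi> \<in> markov_rules \<and>
     (\<forall>(f :: 'e \<Rightarrow> 'a \<Rightarrow> real) B. (\<forall>x. f x \<in> borel_measurable borel) \<longrightarrow> (\<forall>x a. \<bar>f x a\<bar> \<le> B) \<longrightarrow>
       (\<integral>h. f (state n h) (action n h) \<partial>traj q \<nu> \<sigma> N)
         = (\<Sum>x\<in>UNIV. (\<integral>a. f x a \<partial>\<pi> x) * pmf (state_law q \<nu> \<sigma> N n) x))"

context
  fixes q :: "'e::finite \<Rightarrow> 'a::metric_space \<Rightarrow> 'e pmf"
  assumes q: "\<And>x x'. (\<lambda>a. pmf (q x a) x') \<in> borel_measurable borel"
begin

text \<open>
  The state space is finite, so the conditional law can be written down by elementary conditioning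
  on each event \<open>X\<^sub>n = x\<close> of positive probability, with an arbitrary point mass elsewhere.
\<close>
lemma markov_projection_exists:
  assumes \<sigma>: "\<sigma> \<in> policies N" and n: "n < N"
  shows "\<exists>\<pi>. markov_projection q \<nu> \<sigma> N n \<pi>"
proof -
  let ?M = "traj q \<nu> \<sigma> N"
  let ?F = "state_law q \<nu> \<sigma> N n"
  have M: "prob_space ?M" "sets ?M = sets (hist N)"
    using traj_in_prob_algebra[OF q \<sigma>] by (auto simp: space_prob_algebra)
  interpret prob_space ?M by (rule M)
  have [measurable]: "state n \<in> ?M \<rightarrow>\<^sub>M count_space UNIV"
    using measurable_state[of n N] n by (simp add: measurable_cong_sets[OF M(2) refl])
  have [measurable]: "action n \<in> ?M \<rightarrow>\<^sub>M borel"
    using measurable_action[OF n] by (simp add: measurable_cong_sets[OF M(2) refl])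
  define S where "S x = {h \<in> space ?M. state n h = x}" for x
  have [measurable]: "S x \<in> sets ?M" for x unfolding S_def by measurable
  have F: "pmf ?F x = measure ?M (S x)" for x
    unfolding S_def by (rule pmf_state_law[OF q \<sigma>]) (use n in simp)
  define \<pi> where "\<pi> x = (if pmf ?F x = 0 then return borel undefined
     else distr (uniform_measure ?M (S x)) (borel :: 'a measure) (action n))" for x
  have "\<pi> x \<in> space (prob_algebra borel)" for x
  proof (cases "pmf ?F x = 0")
    case False
    then have "prob_space (uniform_measure ?M (S x))"
      by (intro prob_space_uniform_measure) (auto simp: F emeasure_eq_measure)
    then show ?thesis using False
      by (auto simp: \<pi>_def space_prob_algebra intro!: prob_space.prob_space_distr)
  qed (auto simp: \<pi>_def space_prob_algebra intro: prob_space_return)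
  then have "\<pi> \<in> markov_rules" by (simp add: markov_rules_def)
  moreover have "(\<integral>h. f (state n h) (action n h) \<partial>?M) = (\<Sum>x\<in>UNIV. (\<integral>a. f x a \<partial>\<pi> x) * pmf ?F x)"
    if f [measurable]: "\<And>x. f x \<in> borel_measurable borel" and B: "\<And>x a. \<bar>f x a\<bar> \<le> B"
    for f :: "'e \<Rightarrow> 'a \<Rightarrow> real" and B
  proof -
    have part: "(\<integral>a. f x a \<partial>\<pi> x) * pmf ?F x = (\<integral>h. indicator (S x) h * f x (action n h) \<partial>?M)" for x
    proof (cases "pmf ?F x = 0")
      case True
      then have "AE h in ?M. h \<notin> S x"
        by (intro AE_not_in) (simp add: null_sets_def F emeasure_eq_measure)
      then have "(\<integral>h. indicator (S x) h * f x (action n h) \<partial>?M) = 0"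
        by (intro integral_eq_zero_AE) (auto elim: AE_mp)
      then show ?thesis using True by simp
    next
      case False
      then have pos: "0 < pmf ?F x" by (simp add: pmf_pos)
      have "uniform_measure ?M (S x) = density ?M (\<lambda>h. ennreal (indicator (S x) h / pmf ?F x))"
        unfolding uniform_measure_def
        by (intro density_cong) (use pos in \<open>auto simp: F emeasure_eq_measure indicator_def
            divide_ennreal[symmetric]\<close>)
      then have "(\<integral>a. f x a \<partial>\<pi> x) = (\<integral>h. (indicator (S x) h / pmf ?F x) * f x (action n h) \<partial>?M)"
        using False by (simp add: \<pi>_def integral_distr integral_density)
      also have "\<dots> = (\<integral>h. (indicator (S x) h * f x (action n h)) / pmf ?F x \<partial>?M)"
        by (simp add: mult.commute)
      also have "\<dots> = (\<integral>h. indicator (S x) h * f x (action n h) \<partial>?M) / pmf ?F x"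
        by simp
      finally show ?thesis using pos by simp
    qed
    have int: "integrable ?M (\<lambda>h. indicator (S x) h * f x (action n h))" for x
      by (rule integrable_const_bound[where B="\<bar>B\<bar>"])
         (use B in \<open>auto simp: indicator_def intro!: order_trans[OF B]\<close>)
    have "(\<integral>h. f (state n h) (action n h) \<partial>?M)
        = (\<integral>h. (\<Sum>x\<in>UNIV. indicator (S x) h * f x (action n h)) \<partial>?M)"
      by (intro Bochner_Integration.integral_cong)
         (auto simp: S_def indicator_def of_bool_def if_distrib[of "\<lambda>c. c * _"] cong: if_cong)
    also have "\<dots> = (\<Sum>x\<in>UNIV. \<integral>h. indicator (S x) h * f x (action n h) \<partial>?M)"
      by (rule Bochner_Integration.integral_sum) (rule int)
    finally show ?thesis by (simp add: part)
  qed
  ultimately show ?thesis unfolding markov_projection_def by blast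
qed

text \<open>
  The given decision rule itself is a projection of a Markov policy; it may differ from the
  elementary conditional law at unvisited states.
\<close>
lemma markov_projection_Markov_policy:
  assumes \<sigma>: "\<sigma> \<in> policies N" and n: "n < N"
    and \<pi>: "\<pi> \<in> markov_rules" and eq: "\<And>h. \<sigma> n h = \<pi> (state n h)"
  shows "markov_projection q \<nu> \<sigma> N n \<pi>"
  unfolding markov_projection_def
proof (intro conjI allI impI \<pi>)
  fix f :: "'e \<Rightarrow> 'a \<Rightarrow> real" and B
  assume "\<forall>x. f x \<in> borel_measurable borel" "\<forall>x a. \<bar>f x a\<bar> \<le> B"
  then have "(\<integral>h. f (state n h) (action n h) \<partial>traj q \<nu> \<sigma> N)
      = (\<integral>h. \<integral>a. f (state n h) a \<partial>\<pi> (state n h) \<partial>traj q \<nu> \<sigma> n)"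
    by (subst expectation_state_action[OF q \<sigma> n, where B=B]) (simp_all add: eq)
  also have "\<dots> = (\<Sum>x\<in>UNIV. (\<integral>a. f x a \<partial>\<pi> x) * pmf (state_law q \<nu> \<sigma> N n) x)"
    using n by (intro expectation_state[OF q \<sigma>, where g="\<lambda>x. \<integral>a. f x a \<partial>\<pi> x"]) simp
  finally show "(\<integral>h. f (state n h) (action n h) \<partial>traj q \<nu> \<sigma> N)
      = (\<Sum>x\<in>UNIV. (\<integral>a. f x a \<partial>\<pi> x) * pmf (state_law q \<nu> \<sigma> N n) x)" .
qed

text \<open>
  The next state depends on the past only through the current state and action, so the joint law
  of these two, which the projection retains, determines the law of the next state.
\<close>
lemma state_law_markov_projection:
  assumes \<sigma>: "\<sigma> \<in> policies N" and n: "n < N" and \<pi>: "markov_projection q \<nu> \<sigma> N n \<pi>"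
  shows "state_law q \<nu> \<sigma> N (Suc n) = T_op q \<pi> (state_law q \<nu> \<sigma> N n)"
proof (rule pmf_eqI)
  fix x'
  have "\<pi> \<in> markov_rules" using \<pi> by (simp add: markov_projection_def)
  moreover have "(\<integral>h. pmf (q (state n h) (action n h)) x' \<partial>traj q \<nu> \<sigma> N)
      = (\<Sum>x\<in>UNIV. (\<integral>a. pmf (q x a) x' \<partial>\<pi> x) * pmf (state_law q \<nu> \<sigma> N n) x)"
    using \<pi>[unfolded markov_projection_def, THEN conjunct2, rule_format,
        of "\<lambda>x a. pmf (q x a) x'" 1] q by (simp add: pmf_le_1)
  ultimately show "pmf (state_law q \<nu> \<sigma> N (Suc n)) x' = pmf (T_op q \<pi> (state_law q \<nu> \<sigma> N n)) x'"
    by (simp add: pmf_state_law_Suc[OF q \<sigma> n] pmf_T_op[OF q])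
qed

text \<open>
  The objective sees a policy only through the laws of the pairs \<open>(X\<^sub>n, A\<^sub>n)\<close> and of \<open>X\<^sub>N\<close>; its value
  is therefore the total reward of a trajectory in the lifted deterministic model.
\<close>
lemma policy_value_markov_projection:
  assumes \<sigma>: "\<sigma> \<in> policies N" and \<pi>: "\<And>n. n < N \<Longrightarrow> markov_projection q \<nu> \<sigma> N n (\<pi> n)"
    and r: "\<And>x. r x \<in> borel_measurable borel" and B: "\<And>x a. \<bar>r x a\<bar> \<le> B"
  shows "policy_value r q H N \<nu> \<sigma>
    = (\<Sum>n<N. r_hat r (state_law q \<nu> \<sigma> N n) (\<pi> n)) + H (state_law q \<nu> \<sigma> N N)"
proof -
  let ?M = "traj q \<nu> \<sigma> N"
  have M: "prob_space ?M" "sets ?M = sets (hist N)"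
    using traj_in_prob_algebra[OF q \<sigma>] by (auto simp: space_prob_algebra)
  interpret prob_space ?M by (rule M)
  have int: "integrable ?M (\<lambda>h. r (state n h) (action n h))" if "n < N" for n
    by (rule integrable_const_bound[where B=B])
       (use measurable_state_action[of r, OF r that] B in \<open>auto simp: measurable_cong_sets[OF M(2) refl]\<close>)
  have "(\<integral>h. (\<Sum>n<N. r (state n h) (action n h)) \<partial>?M)
      = (\<Sum>n<N. \<integral>h. r (state n h) (action n h) \<partial>?M)"
    by (rule Bochner_Integration.integral_sum) (use int in simp)
  also have "\<dots> = (\<Sum>n<N. r_hat r (state_law q \<nu> \<sigma> N n) (\<pi> n))"
    using \<pi> r B unfolding r_hat_def markov_projection_def by (intro sum.cong) blast+
  finally show ?thesis by (simp add: policy_value_def)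
qed

end

section \<open>Optimality\<close>

context
  fixes q :: "'e::finite \<Rightarrow> 'a::metric_space \<Rightarrow> 'e pmf" and r :: "'e \<Rightarrow> 'a \<Rightarrow> real" and B :: real
  assumes q: "\<And>x x'. (\<lambda>a. pmf (q x a) x') \<in> borel_measurable borel"
    and r: "\<And>x. r x \<in> borel_measurable borel" and B: "\<And>x a. \<bar>r x a\<bar> \<le> B"
begin

lemma policy_value_le_J:
  assumes \<sigma>: "\<sigma> \<in> policies N"
  shows "ereal (policy_value r q H N \<nu> \<sigma>) \<le> J r q H N 0 \<nu>"
proof -
  define \<pi> where "\<pi> n = (SOME \<pi>. markov_projection q \<nu> \<sigma> N n \<pi>)" for n
  have \<pi>: "markov_projection q \<nu> \<sigma> N n (\<pi> n)" if "n < N" for n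
    unfolding \<pi>_def by (rule someI_ex[OF markov_projection_exists[OF q \<sigma> that]])
  have M: "\<pi> n \<in> markov_rules" if "n < N" for n
    using \<pi>[OF that] by (simp add: markov_projection_def)
  show ?thesis
    using J_ge_lifted_trajectory[where F="state_law q \<nu> \<sigma> N" and n=0 and q=q and r=r
          and H=H and \<pi>=\<pi> and N=N,
        OF M state_law_markov_projection[OF q \<sigma> _ \<pi>]]
    by (simp add: policy_value_markov_projection[OF q \<sigma> \<pi> r B] state_law_0[OF q \<sigma>]
        atLeast0LessThan)
qed

lemma feedback_policy_in_policies:
  assumes f: "\<And>n. n < N \<Longrightarrow> is_maximizer r q H N n (f n)"
  shows "feedback_policy q \<nu> f \<in> policies N"
  unfolding policies_def
proof (intro CollectI allI impI)
  fix n assume "n < N"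
  then have "f n (lifted_state q \<nu> f n) \<in> count_space UNIV \<rightarrow>\<^sub>M prob_algebra borel"
    using J_maximizer(1)[OF f] by (auto simp: markov_rules_def)
  from measurable_compose[OF measurable_state[OF order_refl] this]
  show "feedback_policy q \<nu> f n \<in> hist n \<rightarrow>\<^sub>M prob_algebra borel"
    by (simp add: feedback_policy_def[abs_def])
qed

text \<open>
  Under the feedback policy the state laws follow the trajectory of distributions that the
  maximizers generate in the lifted model, so its value is the value of that trajectory.
\<close>
lemma policy_value_feedback_policy:
  assumes f: "\<And>n. n < N \<Longrightarrow> is_maximizer r q H N n (f n)"
  shows "ereal (policy_value r q H N \<nu> (feedback_policy q \<nu> f)) = J r q H N 0 \<nu>"
proof -
  let ?\<sigma> = "feedback_policy q \<nu> f" and ?F = "lifted_state q \<nu> f"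
  have \<sigma>: "?\<sigma> \<in> policies N" by (rule feedback_policy_in_policies[OF f])
  have proj: "markov_projection q \<nu> ?\<sigma> N n (f n (?F n))" if "n < N" for n
    using that J_maximizer(1)[OF f]
    by (intro markov_projection_Markov_policy[OF q \<sigma>]) (auto simp: feedback_policy_def)
  have law: "state_law q \<nu> ?\<sigma> N n = ?F n" if "n \<le> N" for n
    using that
  proof (induction n)
    case 0
    then show ?case by (simp add: state_law_0[OF q \<sigma>])
  next
    case (Suc n)
    then show ?case using state_law_markov_projection[OF q \<sigma> _ proj, of n] by simp
  qed
  have "policy_value r q H N \<nu> ?\<sigma> = (\<Sum>n<N. r_hat r (?F n) (f n (?F n))) + H (?F N)"
    by (simp add: policy_value_markov_projection[OF q \<sigma> proj r B] law)
  moreover have "J r q H N 0 (?F 0) = ereal ((\<Sum>n\<in>{0..<N}. r_hat r (?F n) (f n (?F n))) + H (?F N))"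
    by (rule J_eq_maximizing_trajectory[OF f]) auto
  ultimately show ?thesis by (simp add: atLeast0LessThan)
qed

lemma J_eq_Sup_policy_value:
  assumes f: "\<And>n. n < N \<Longrightarrow> is_maximizer r q H N n (f n)"
  shows "J r q H N 0 \<nu> = (SUP \<sigma>\<in>policies N. ereal (policy_value r q H N \<nu> \<sigma>))"
proof (rule antisym)
  show "J r q H N 0 \<nu> \<le> (SUP \<sigma>\<in>policies N. ereal (policy_value r q H N \<nu> \<sigma>))"
    using feedback_policy_in_policies[OF f] policy_value_feedback_policy[OF f, of \<nu>]
    by (intro SUP_upper2[of "feedback_policy q \<nu> f"]) auto
  show "(SUP \<sigma>\<in>policies N. ereal (policy_value r q H N \<nu> \<sigma>)) \<le> J r q H N 0 \<nu>"
    by (rule SUP_least) (rule policy_value_le_J)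
qed

end

lemma bounded_reward:
  fixes r :: "'e::finite \<Rightarrow> 'a::metric_space \<Rightarrow> real"
  assumes A: "compact (UNIV :: 'a set)" and r: "\<And>x. continuous_on UNIV (\<lambda>a. r x a)"
  obtains B where "\<And>x a. \<bar>r x a\<bar> \<le> B"
proof -
  have "bounded (\<Union>x. range (r x))"
    using compact_imp_bounded[OF compact_continuous_image[OF r A]] by (intro bounded_UN) auto
  then obtain B where "\<forall>y\<in>(\<Union>x. range (r x)). norm y \<le> B"
    by (auto simp: bounded_iff)
  then show ?thesis by (intro that[of B]) auto
qed

theorem theorem3p1:
  fixes N :: nat
    and \<nu> :: "'e::finite pmf"
    and r :: "'e \<Rightarrow> 'a::metric_space \<Rightarrow> real"
    and q :: "'e \<Rightarrow> 'a \<Rightarrow> 'e pmf"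
    and H :: "'e pmf \<Rightarrow> real"
  assumes "compact (UNIV :: 'a set)"
    and "usc_on_pmf H"
    and "\<And>x x'. continuous_on UNIV (\<lambda>a. pmf (q x a) x')"
    and "\<And>x. continuous_on UNIV (\<lambda>a. r x a)"
  shows "J r q H N 0 \<nu> = (SUP \<sigma>\<in>policies N. ereal (policy_value r q H N \<nu> \<sigma>))
    \<and> (\<forall>n<N. \<exists>f. is_maximizer r q H N n f)
    \<and> (\<forall>f. (\<forall>n<N. is_maximizer r q H N n (f n)) \<longrightarrow>
          feedback_policy q \<nu> f \<in> policies N
          \<and> ereal (policy_value r q H N \<nu> (feedback_policy q \<nu> f)) =
              (SUP \<sigma>\<in>policies N. ereal (policy_value r q H N \<nu> \<sigma>)))"
proof -
  have q: "(\<lambda>a. pmf (q x a) x') \<in> borel_measurable borel" for x x'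
    by (rule borel_measurable_continuous_onI[OF assms(3)])
  have r: "r x \<in> borel_measurable borel" for x
    using borel_measurable_continuous_onI[OF assms(4)] .
  obtain B where B: "\<And>x a. \<bar>r x a\<bar> \<le> B"
    by (rule bounded_reward[OF assms(1,4)]) (rule that)
  have ex: "\<exists>f. is_maximizer r q H N n f" if "n < N" for n
    by (rule is_maximizer_exists[OF assms(1,3,4,2) that])
  define f where "f n = (SOME f. is_maximizer r q H N n f)" for n
  have f: "is_maximizer r q H N n (f n)" if "n < N" for n
    unfolding f_def by (rule someI_ex[OF ex[OF that]])
  have sup: "J r q H N 0 \<nu> = (SUP \<sigma>\<in>policies N. ereal (policy_value r q H N \<nu> \<sigma>))"
    by (rule J_eq_Sup_policy_value[OF q r B f])
  have opt: "feedback_policy q \<nu> f \<in> policies N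
      \<and> ereal (policy_value r q H N \<nu> (feedback_policy q \<nu> f))
        = (SUP \<sigma>\<in>policies N. ereal (policy_value r q H N \<nu> \<sigma>))"
    if "\<forall>n<N. is_maximizer r q H N n (f n)" for f
    unfolding sup[symmetric]
    by (intro conjI feedback_policy_in_policies[OF q r B that[rule_format]]
        policy_value_feedback_policy[OF q r B that[rule_format]])
  show ?thesis
    by (intro conjI allI impI sup ex) (simp_all only: opt)
qed

end
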